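(* Let $L_0,L_1\ge 0$ and let $f:\mathbb{R}^d\to\mathbb{R}$ be a differentiable convex function that is $(L_0,L_1)$-smooth and attains its minimum $f^*$ at some point $x^*$. Let $x^0\in\mathbb{R}^d$, $R:=\|x^0-x^*\|$, $F_0:=f(x^0)-f^*$, and let $N\ge 1$ be an integer. Let $x^0,x^1,\dots,x^N$ be generated by normalized gradient descent $$x^{k+1}=x^k-\eta\,\frac{\nabla f(x^k)}{\|\nabla f(x^k)\|},\qquad k=0,\dots,N-1,$$ with a constant step size $0<\eta\le \frac{c}{L_0+L_1c}$, where $c>0$ is a constant such that $\|\nabla f(x^k)\|\ge c$ for all $k=0,1,\dots,N-1$. Then $$f(x^N)-f^*\le\Big(1-\frac{\eta}{2R}\Big)^N F_0 .$$
   Context: $\|\cdot\|$ is the Euclidean norm on $\mathbb{R}^d$. A differentiable function $f:\mathbb{R}^d\to\mathbb{R}$ is $(L_0,L_1)$-smooth if for all $x,y\in\mathbb{R}^d$ with $\|y-x\|\le \frac{1}{L_1}$ (no restriction if $L_1=0$) one has $\|\nabla f(y)-\nabla f(x)\|\le (L_0+L_1\|\nabla f(x)\|)\,\|y-x\|$. *)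

theory Defs
  imports "HOL-Analysis.Analysis"
begin

definition grad :: "('a::euclidean_space \<Rightarrow> real) \<Rightarrow> 'a \<Rightarrow> 'a" where
  "grad f x = (THE D. GDERIV f x :> D)"

text \<open>The gradient is the intended one at every point of differentiability.\<close>

lemma GDERIV_grad:
  fixes f :: "'a::euclidean_space \<Rightarrow> real"
  assumes "f differentiable (at x)"
  shows "GDERIV f x :> grad f x"
proof -
  obtain f' where f': "(f has_derivative f') (at x)"
    using assms by (auto simp: differentiable_def)
  have "f' = (\<lambda>h. h \<bullet> adjoint f' 1)"
    using adjoint_works[OF has_derivative_linear[OF f'], of _ 1]
    by (simp add: fun_eq_iff)
  with f' have ex: "GDERIV f x :> adjoint f' 1"
    by (simp add: gderiv_def)
  have "D = D'" if "GDERIV f x :> D" "GDERIV f x :> D'" for D D'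
  proof -
    have "(\<lambda>h. h \<bullet> D) = (\<lambda>h. h \<bullet> D')"
      using that by (auto simp: gderiv_def intro: has_derivative_unique)
    then show ?thesis
      by (metis vector_eq_ldot)
  qed
  with ex show ?thesis
    unfolding grad_def by (intro theI[where P = "\<lambda>D. GDERIV f x :> D"]) auto
qed

text \<open>The disjunct \<open>L1 = 0\<close> encodes the convention \<open>1 / L1 = \<infinity>\<close> in that case
  (in HOL, \<open>1 / 0 = 0\<close>).\<close>

definition L0_L1_smooth :: "real \<Rightarrow> real \<Rightarrow> ('a::euclidean_space \<Rightarrow> real) \<Rightarrow> bool" where
  "L0_L1_smooth L0 L1 f \<longleftrightarrow>
     (\<forall>x. f differentiable (at x)) \<and>
     (\<forall>x y. L1 = 0 \<or> norm (y - x) \<le> 1 / L1 \<longrightarrow>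
        norm (grad f y - grad f x) \<le> (L0 + L1 * norm (grad f x)) * norm (y - x))"

end

theory Submission imports Defs begin

text \<open>
  Write \<open>g\<^sub>k\<close> for the gradient at \<open>x k\<close> and \<open>F\<^sub>k = f (x k) - f xstar\<close>. Integrating the smoothness
  bound along a segment gives a quadratic upper model of \<open>f\<close> with curvature
  \<open>L0 + L1 * norm g\<^sub>k\<close>. The step-size condition says that \<open>\<eta>\<close> is at most \<open>G / (L0 + L1 * G)\<close>
  for \<open>G = c\<close>, hence also for every \<open>G \<ge> c\<close>, since that quotient increases with \<open>G\<close>. So each
  step decreases \<open>f\<close> by at least \<open>\<eta> * norm g\<^sub>k / 2\<close> (\<open>normalized_step_descent\<close>).

  This one decrease serves twice. Since \<open>f\<close> cannot fall below its minimum, it forces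
  \<open>F\<^sub>k \<ge> \<eta> * norm g\<^sub>k / 2\<close>; by convexity the inner product of \<open>x k - xstar\<close> with \<open>g\<^sub>k\<close> is at
  least \<open>F\<^sub>k\<close>, and this is exactly what makes the step no longer increase the distance to
  \<open>xstar\<close> (\<open>normalized_step_dist_le\<close>). Hence all iterates stay within \<open>R = norm (x 0 - xstar)\<close>
  of \<open>xstar\<close>. Convexity and Cauchy-Schwarz then give \<open>F\<^sub>k \<le> R * norm g\<^sub>k\<close>, which turns the
  decrease into the contraction \<open>F\<^sub>k\<^sub>+\<^sub>1 \<le> (1 - \<eta> / (2 * R)) * F\<^sub>k\<close>.
\<close>

lemma has_real_derivative_along_line:
  fixes f :: "'a::euclidean_space \<Rightarrow> real"
  assumes "\<And>z. f differentiable (at z)"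
  shows "((\<lambda>t. f (a + t *\<^sub>R h)) has_real_derivative (h \<bullet> grad f (a + t *\<^sub>R h))) (at t within S)"
proof -
  have *: "(f has_derivative (\<lambda>v. v \<bullet> grad f (a + t *\<^sub>R h))) (at (a + t *\<^sub>R h))"
    using GDERIV_grad[OF assms] by (simp add: gderiv_def)
  have "((\<lambda>t. a + t *\<^sub>R h) has_derivative (\<lambda>s. s *\<^sub>R h)) (at t within S)"
    by (auto intro!: derivative_eq_intros)
  from has_derivative_compose[OF this *]
  show ?thesis
    by (simp add: has_field_derivative_def mult_commute_abs)
qed

lemma convex_above_gradient:
  fixes f :: "'a::euclidean_space \<Rightarrow> real"
  assumes "\<And>z. f differentiable (at z)" and "convex_on UNIV f"
  shows "f a - f b \<le> (a - b) \<bullet> grad f a"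
proof -
  have "convex_on UNIV (\<lambda>t. f (a + t *\<^sub>R (b - a)))"
  proof (rule convex_onI)
    fix t u v :: real
    assume "0 < t" "t < 1"
    moreover have "a + ((1 - t) *\<^sub>R u + t *\<^sub>R v) *\<^sub>R (b - a)
        = (1 - t) *\<^sub>R (a + u *\<^sub>R (b - a)) + t *\<^sub>R (a + v *\<^sub>R (b - a))"
      by (simp add: algebra_simps)
    ultimately show "f (a + ((1 - t) *\<^sub>R u + t *\<^sub>R v) *\<^sub>R (b - a))
        \<le> (1 - t) * f (a + u *\<^sub>R (b - a)) + t * f (a + v *\<^sub>R (b - a))"
      using convex_onD[OF assms(2), of t "a + u *\<^sub>R (b - a)" "a + v *\<^sub>R (b - a)"] by simp
  qed simp
  from convex_on_imp_above_tangent[OF this _ _ _ has_real_derivative_along_line[OF assms(1)], of 0 1]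
  show ?thesis
    by (simp add: algebra_simps)
qed

text \<open>
  The difference between \<open>f\<close> and the quadratic model is nonincreasing along the segment from \<open>a\<close>
  to \<open>a + h\<close>: its derivative at \<open>t\<close> is the inner product of \<open>h\<close> with the change of the gradient,
  at most \<open>L * t * (norm h)\<^sup>2\<close> by smoothness, minus the same quantity from the model. The
  norm bound on \<open>h\<close> keeps the whole segment in the region where smoothness may be used.
\<close>

lemma L0_L1_smooth_upper_model:
  fixes f :: "'a::euclidean_space \<Rightarrow> real"
  assumes smooth: "L0_L1_smooth L0 L1 f" and h: "L1 = 0 \<or> norm h \<le> 1 / L1"
  shows "f (a + h) \<le> f a + h \<bullet> grad f a + (L0 + L1 * norm (grad f a)) / 2 * (norm h)\<^sup>2"
proof -
  define L where "L = L0 + L1 * norm (grad f a)"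
  have diff: "\<And>z. f differentiable (at z)"
    using smooth by (simp add: L0_L1_smooth_def)
  define \<psi> where "\<psi> = (\<lambda>t. f (a + t *\<^sub>R h) - t * (h \<bullet> grad f a) - L / 2 * (norm h)\<^sup>2 * t\<^sup>2)"
  have "\<psi> 1 \<le> \<psi> 0"
  proof (rule DERIV_nonpos_imp_nonincreasing[of 0 1 \<psi>])
    fix t :: real
    assume t: "0 \<le> t" "t \<le> 1"
    let ?D = "h \<bullet> (grad f (a + t *\<^sub>R h) - grad f a) - L * (norm h)\<^sup>2 * t"
    have "(\<psi> has_real_derivative ?D) (at t)"
      unfolding \<psi>_def
      by (rule derivative_eq_intros has_real_derivative_along_line[OF diff] refl)+
         (simp add: inner_diff_right)
    moreover have "?D \<le> 0"
    proof -
      have "norm (t *\<^sub>R h) \<le> norm h"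
        using t by (simp add: mult_left_le_one_le)
      then have "L1 = 0 \<or> norm (a + t *\<^sub>R h - a) \<le> 1 / L1"
        using h by auto
      then have "norm (grad f (a + t *\<^sub>R h) - grad f a) \<le> L * norm (a + t *\<^sub>R h - a)"
        using smooth unfolding L0_L1_smooth_def L_def by blast
      then have "norm h * norm (grad f (a + t *\<^sub>R h) - grad f a) \<le> norm h * (L * (t * norm h))"
        using t by (intro mult_left_mono) auto
      with norm_cauchy_schwarz[of h "grad f (a + t *\<^sub>R h) - grad f a"] show ?thesis
        by (simp add: power2_eq_square algebra_simps)
    qed
    ultimately show "\<exists>y. (\<psi> has_real_derivative y) (at t) \<and> y \<le> 0"
      by blast
  qed simp
  then show ?thesis
    by (simp add: \<psi>_def L_def)
qed

text \<open>
  For a step of length \<open>\<eta>\<close> along the negative gradient the model predicts the change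
  \<open>- \<eta> * G + (L0 + L1 * G) / 2 * \<eta>\<^sup>2\<close> with \<open>G = norm (grad f a)\<close>, and the
  upper bound on \<open>\<eta>\<close> says that the quadratic term cancels at most half of the linear one.
\<close>

lemma normalized_step_descent:
  fixes f :: "'a::euclidean_space \<Rightarrow> real"
  assumes smooth: "L0_L1_smooth L0 L1 f" and nonneg: "L0 \<ge> 0" "L1 \<ge> 0"
    and step: "\<eta> > 0" "\<eta> * (L0 + L1 * norm (grad f a)) \<le> norm (grad f a)"
    and g: "grad f a \<noteq> 0"
  shows "f (a - \<eta> *\<^sub>R (grad f a /\<^sub>R norm (grad f a))) \<le> f a - \<eta> * norm (grad f a) / 2"
proof -
  define G where "G = norm (grad f a)"
  define h where "h = - (\<eta> *\<^sub>R (grad f a /\<^sub>R G))"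
  have G: "G > 0"
    using g by (simp add: G_def)
  have norm_h: "norm h = \<eta>"
    using step(1) g by (simp add: h_def G_def)
  have inner_h: "h \<bullet> grad f a = - \<eta> * G"
    using G by (simp add: h_def dot_square_norm power2_eq_square flip: G_def)
  have "L1 = 0 \<or> norm h \<le> 1 / L1"
  proof (cases "L1 = 0")
    case False
    have "\<eta> * L1 * G \<le> \<eta> * (L0 + L1 * G)"
      using step(1) nonneg by (simp add: algebra_simps)
    also have "\<dots> \<le> 1 * G"
      using step(2) by (simp flip: G_def)
    finally have "\<eta> * L1 \<le> 1"
      using G by (simp only: mult_le_cancel_right_pos)
    then show ?thesis
      using False nonneg norm_h by (simp add: field_simps)
  qed simp
  from L0_L1_smooth_upper_model[OF smooth this, of a]
  have "f (a + h) \<le> f a - \<eta> * G + \<eta> * (\<eta> * (L0 + L1 * G)) / 2"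
    by (simp add: norm_h inner_h power2_eq_square algebra_simps flip: G_def)
  moreover have "\<eta> * (\<eta> * (L0 + L1 * G)) \<le> \<eta> * G"
    using step by (simp flip: G_def)
  ultimately have "f (a + h) \<le> f a - \<eta> * G / 2"
    by argo
  then show ?thesis
    by (simp add: h_def G_def)
qed

text \<open>
  The squared distance changes by \<open>\<eta>\<^sup>2\<close> minus \<open>2 * \<eta>\<close> times the component of \<open>a - p\<close> along
  the unit vector, so it cannot grow once that component is at least \<open>\<eta> / 2\<close>.
\<close>

lemma normalized_step_dist_le:
  fixes a p g :: "'a::real_inner"
  assumes "\<eta> > 0" "g \<noteq> 0" and inner: "\<eta> * norm g / 2 \<le> (a - p) \<bullet> g"
  shows "norm (a - \<eta> *\<^sub>R (g /\<^sub>R norm g) - p) \<le> norm (a - p)"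
proof -
  define u where "u = g /\<^sub>R norm g"
  have u: "u \<bullet> u = 1"
    using assms(2) by (simp add: u_def dot_square_norm power2_eq_square)
  have "(a - p) \<bullet> u \<ge> \<eta> / 2"
    using inner assms(2) by (simp add: u_def field_simps)
  then have "\<eta> * (\<eta> / 2) \<le> \<eta> * ((a - p) \<bullet> u)"
    using assms(1) by (intro mult_left_mono) auto
  moreover have "(norm ((a - p) - \<eta> *\<^sub>R u))\<^sup>2 = (norm (a - p))\<^sup>2 - 2 * (\<eta> * ((a - p) \<bullet> u)) + \<eta> * \<eta>"
    unfolding power2_norm_eq_inner
    by (simp add: inner_diff_left inner_diff_right inner_commute u algebra_simps)
  ultimately have "(norm ((a - p) - \<eta> *\<^sub>R u))\<^sup>2 \<le> (norm (a - p))\<^sup>2"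
    by simp
  then have "norm ((a - p) - \<eta> *\<^sub>R u) \<le> norm (a - p)"
    by (rule power2_le_imp_le) simp
  then show ?thesis
    by (simp add: u_def algebra_simps)
qed

theorem theorem3p3:
  fixes f :: "real ^ 'd \<Rightarrow> real"
    and x :: "nat \<Rightarrow> real ^ 'd"
    and xstar :: "real ^ 'd"
    and L0 L1 \<eta> c :: real
    and N :: nat
  assumes "L0 \<ge> 0" and "L1 \<ge> 0"
    and "\<And>z. f differentiable (at z)"
    and "convex_on UNIV f"
    and "L0_L1_smooth L0 L1 f"
    and "\<And>z. f xstar \<le> f z"
    and "N \<ge> 1"
    and "\<And>k. k < N \<Longrightarrow> x (Suc k) = x k - \<eta> *\<^sub>R (grad f (x k) /\<^sub>R norm (grad f (x k)))"
    and "c > 0"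
    and "\<And>k. k < N \<Longrightarrow> norm (grad f (x k)) \<ge> c"
    and "\<eta> > 0"
    and "L0 + L1 * c = 0 \<or> \<eta> \<le> c / (L0 + L1 * c)"
  shows "f (x N) - f xstar \<le> (1 - \<eta> / (2 * norm (x 0 - xstar))) ^ N * (f (x 0) - f xstar)"
proof -
  define R where "R = norm (x 0 - xstar)"
  define G where "G k = norm (grad f (x k))" for k
  define F where "F k = f (x k) - f xstar" for k
  have F_nonneg: "F k \<ge> 0" for k
    using assms(6) by (simp add: F_def)
  have G_pos: "G k > 0" if "k < N" for k
    using assms(9,10) that by (fastforce simp: G_def)
  then have g_nonzero: "grad f (x k) \<noteq> 0" if "k < N" for k
    using that by (force simp: G_def)
  \<comment> \<open>This form has no division, so it covers \<open>L0 = L1 = 0\<close> as well.\<close>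
  have step: "\<eta> * (L0 + L1 * c) \<le> c"
    using assms(12)
  proof
    assume "\<eta> \<le> c / (L0 + L1 * c)"
    then show ?thesis
      using assms(1,2,9) by (cases "L0 + L1 * c = 0") (auto simp: pos_le_divide_eq less_le)
  qed (use assms(9) in simp)
  \<comment> \<open>Written as \<open>\<eta> * L0 \<le> c * (1 - \<eta> * L1)\<close>, the bound survives enlarging \<open>c\<close> to \<open>G k\<close>,
     because the factor of \<open>c\<close> is nonnegative.\<close>
  have "\<eta> * (L0 + L1 * G k) \<le> G k" if "k < N" for k
  proof -
    have "c * (\<eta> * L1) \<le> c * 1"
    proof -
      have "0 \<le> \<eta> * L0"
        using assms(1,11) by simp
      with step show ?thesis
        by (simp add: algebra_simps)
    qed
    then have "\<eta> * L1 \<le> 1"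
      using assms(9) by (simp only: mult_le_cancel_left_pos)
    then have "c * (1 - \<eta> * L1) \<le> G k * (1 - \<eta> * L1)"
      using assms(10)[OF that] by (intro mult_right_mono) (auto simp: G_def)
    then show ?thesis
      using step by (simp add: algebra_simps)
  qed
  then have descent: "F (Suc k) \<le> F k - \<eta> * G k / 2" if "k < N" for k
    using normalized_step_descent[OF assms(5,1,2,11), of "x k"] g_nonzero that
    by (simp add: assms(8) F_def G_def)
  have F_le_inner: "F k \<le> (x k - xstar) \<bullet> grad f (x k)" for k
    unfolding F_def by (rule convex_above_gradient[OF assms(3,4)])
  have F_lower: "\<eta> * G k / 2 \<le> F k" if "k < N" for k
    using descent[OF that] F_nonneg[of "Suc k"] by linarith
  have dist_le: "norm (x k - xstar) \<le> R" if "k \<le> N" for k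
    using that
  proof (induction k)
    case (Suc k)
    have "norm (x (Suc k) - xstar) \<le> norm (x k - xstar)"
      unfolding assms(8)[OF Suc_le_lessD[OF Suc.prems]]
      using F_lower[of k] F_le_inner[of k] Suc.prems
      by (intro normalized_step_dist_le assms(11) g_nonzero) (auto simp: G_def)
    with Suc show ?case
      by simp
  qed (simp add: R_def)
  have F_le: "F k \<le> R * G k" if "k \<le> N" for k
  proof -
    have "F k \<le> norm (x k - xstar) * G k"
      using F_le_inner[of k] norm_cauchy_schwarz[of "x k - xstar" "grad f (x k)"]
      by (simp add: G_def)
    also have "\<dots> \<le> R * G k"
      using dist_le[OF that] by (intro mult_right_mono) (auto simp: G_def)
    finally show ?thesis .
  qed
  have "N > 0"
    using assms(7) by simp
  have F0_pos: "F 0 > 0"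
    using F_lower[OF \<open>N > 0\<close>] mult_pos_pos[OF assms(11) G_pos[OF \<open>N > 0\<close>]] by linarith
  have R_pos: "R > 0"
    using F0_pos F_le[of 0] G_pos[OF \<open>N > 0\<close>] by (fastforce simp: R_def)
  have contraction: "F (Suc k) \<le> (1 - \<eta> / (2 * R)) * F k" if "k < N" for k
  proof -
    have "\<eta> / (2 * R) * F k \<le> \<eta> / (2 * R) * (R * G k)"
      using F_le[of k] that R_pos assms(11) by (intro mult_left_mono) auto
    also have "\<dots> = \<eta> * G k / 2"
      using R_pos by simp
    finally show ?thesis
      using descent[OF that] by (simp add: algebra_simps)
  qed
  \<comment> \<open>The factor is nonnegative because the first step takes \<open>F 0 > 0\<close> to a nonnegative value.\<close>
  have factor_nonneg: "1 - \<eta> / (2 * R) \<ge> 0"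
  proof (rule ccontr)
    assume "\<not> 1 - \<eta> / (2 * R) \<ge> 0"
    then have "(1 - \<eta> / (2 * R)) * F 0 < 0"
      using F0_pos by (intro mult_neg_pos) auto
    then show False
      using contraction[OF \<open>N > 0\<close>] F_nonneg[of "Suc 0"] by linarith
  qed
  have "F k \<le> (1 - \<eta> / (2 * R)) ^ k * F 0" if "k \<le> N" for k
    using that
  proof (induction k)
    case (Suc k)
    have "F (Suc k) \<le> (1 - \<eta> / (2 * R)) * F k"
      using contraction Suc.prems by simp
    also have "\<dots> \<le> (1 - \<eta> / (2 * R)) * ((1 - \<eta> / (2 * R)) ^ k * F 0)"
      using Suc factor_nonneg by (intro mult_left_mono) auto
    finally show ?case
      by (simp add: mult.assoc)
  qed simp
  then show ?thesis
    by (simp add: F_def R_def)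
qed

end
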